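(* Let $U,V$ be vector spaces over a field, let $\rho$ be a Lie algebra structure on $U$, let $\theta$ be a Lie algebra structure on $V$, and let $\Phi:(U,\rho)\to(V,\theta)$ be a Lie algebra morphism. For $p\ge 0$ let $\Lambda^p(U,V)$ be the space of $p$-cochains and $\Delta^p:\Lambda^p(U,V)\to\Lambda^{p+1}(U,V)$ the operator associated to the triple $(\rho,\theta,\Phi)$, both as defined in the context. Then for every $p\ge 0$ $$\Delta^{p+1}\circ\Delta^p=0,$$ and hence $(\Lambda^p(U,V),\Delta^p)_{p\ge 0}$ forms a complex.
   Context: For vector spaces $A,B$ and $p\ge 1$, $\bigwedge^p(A,B)$ denotes the space of $p$-linear skew-symmetric (alternating) maps from $A$ to $B$. A Lie algebra structure on $U$ is a $\rho\in\bigwedge^2(U,U)$ satisfying the Jacobi identity $\rho(\rho(a,b),c)+\rho(\rho(b,c),a)+\rho(\rho(c,a),b)=0$ for all $a,b,c\in U$; similarly for $\theta$ on $V$. A Lie algebra morphism $\Phi:(U,\rho)\to(V,\theta)$ is a linear map with $\Phi(\rho(a,b))=\theta(\Phi(a),\Phi(b))$ for all $a,b\in U$. **Coboundary of a morphism.** For a morphism $\Phi:(U,\rho)\to(V,\theta)$, the map $\delta^p:\bigwedge^p(U,V)\to\bigwedge^{p+1}(U,V)$ is $$\delta^p\psi(x_1,\dots,x_{p+1})=\sum_{1\le s\le p+1}(-1)^s\,\theta\big(\Phi(x_s),\psi(x_1,\dots,\widehat{x_s},\dots,x_{p+1})\big)+\sum_{1\le s<t\le p+1}(-1)^{s+t-1}\,\psi\big(\rho(x_s,x_t),x_1,\dots,\widehat{x_s},\dots,\widehat{x_t},\dots,x_{p+1}\big),$$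 where a hat denotes omission. **Coboundary of a Lie algebra.** The map $\delta^p:\bigwedge^p(U,U)\to\bigwedge^{p+1}(U,U)$ is given by the same formula with $V=U$, $\theta=\rho$, $\Phi=\mathrm{id}_U$. The map $\delta^p:\bigwedge^p(V,V)\to\bigwedge^{p+1}(V,V)$ is given by the same formula with $U$ replaced by $V$, $\rho$ replaced by $\theta$, and $\Phi=\mathrm{id}_V$. **Cochains.** For $p\ge 0$, $$\Lambda^p(U,V)=\textstyle\bigwedge^{p+1}(U,U)\oplus\bigwedge^{p+1}(V,V)\oplus\bigwedge^{p}(U,V),$$ with the convention that $\bigwedge^0(U,V)=0$ (so the third summand is zero when $p=0$, and $\delta^0$ is the zero map on it). **The operation $\diamond$.** For $\lambda\in\bigwedge^p(V,V)$ and a linear map $\Phi:U\to V$, $\lambda\diamond\Phi\in\bigwedge^p(U,V)$ is defined by $(\lambda\diamond\Phi)(x_1,\dots,x_p)=\lambda(\Phi(x_1),\dots,\Phi(x_p))$ for $x_1,\dots,x_p\in U$. **The operator $\Delta^p$.** For $(X_1,X_2,X_3)\in\Lambda^p(U,V)$, $$\Delta^p(X_1,X_2,X_3)=\Big(\delta^{p+1}(X_1),\ \delta^{p+1}(X_2),\ \delta^p(X_3)+(-1)^p\big(\Phi\circ X_1-X_2\diamond\Phi\big)\Big),$$ where $\delta^{p+1}(X_1)$, $\delta^{p+1}(X_2)$ use the Lie algebra coboundaries of $(U,\rho)$ and $(V,\theta)$, and $\delta^p(X_3)$ uses the coboundary of the morphism $\Phi$. *)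

theory Defs
  imports Complex_Main "HOL-Library.Function_Algebras" "HOL-Library.Product_Plus"
begin

text \<open>
  Vector spaces over a field \<^typ>\<open>'k\<close> are given by a scalar multiplication
  \<^term>\<open>s :: 'k::field \<Rightarrow> 'a::ab_group_add \<Rightarrow> 'a\<close> satisfying \<^term>\<open>vector_space s\<close>.
  A \<open>p\<close>-ary map is a function on argument lists which vanishes on all lists of length other
  than \<open>p\<close>, so that equality of such functions is equality of \<open>p\<close>-ary maps.
\<close>

definition alt_maps ::
    "('k::field \<Rightarrow> 'a::ab_group_add \<Rightarrow> 'a) \<Rightarrow> ('k \<Rightarrow> 'b::ab_group_add \<Rightarrow> 'b) \<Rightarrow> nat
      \<Rightarrow> ('a list \<Rightarrow> 'b) set" where
  "alt_maps sA sB p =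
    (if p = 0 then {0}  \<comment> \<open>by convention, not the constants\<close>
     else {f. (\<forall>xs. length xs \<noteq> p \<longrightarrow> f xs = 0) \<and>
              (\<forall>xs i. length xs = p \<and> i < p \<longrightarrow>
                 Vector_Spaces.linear sA sB (\<lambda>x. f (xs[i := x]))) \<and>
              (\<forall>xs. length xs = p \<and> \<not> distinct xs \<longrightarrow> f xs = 0)})"

definition lie_structure ::
    "('k::field \<Rightarrow> 'a::ab_group_add \<Rightarrow> 'a) \<Rightarrow> ('a list \<Rightarrow> 'a) \<Rightarrow> bool" where
  "lie_structure s \<rho> \<longleftrightarrow>
    \<rho> \<in> alt_maps s s 2 \<and>
    (\<forall>a b c. \<rho> [\<rho> [a, b], c] + \<rho> [\<rho> [b, c], a] + \<rho> [\<rho> [c, a], b] = 0)"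

definition lie_morphism ::
    "('k::field \<Rightarrow> 'u::ab_group_add \<Rightarrow> 'u) \<Rightarrow> ('k \<Rightarrow> 'v::ab_group_add \<Rightarrow> 'v)
      \<Rightarrow> ('u list \<Rightarrow> 'u) \<Rightarrow> ('v list \<Rightarrow> 'v) \<Rightarrow> ('u \<Rightarrow> 'v) \<Rightarrow> bool" where
  "lie_morphism sU sV \<rho> \<theta> \<Phi> \<longleftrightarrow>
    Vector_Spaces.linear sU sV \<Phi> \<and> (\<forall>a b. \<Phi> (\<rho> [a, b]) = \<theta> [\<Phi> a, \<Phi> b])"

text \<open>
  The list \<open>xs = [x\<^sub>1, \<dots>, x\<^sub>n]\<close> with the entries whose (1-based) positions lie in \<open>S\<close> omitted.
\<close>

definition omit :: "nat set \<Rightarrow> 'a list \<Rightarrow> 'a list" where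
  "omit S xs = nths xs {i. Suc i \<notin> S}"

text \<open>
  Indices \<open>s, t\<close> below are 1-based, hence \<open>x\<^sub>s\<close> is \<^term>\<open>xs ! (s - 1)\<close>; the signs are scalars
  of the field.
\<close>

definition coboundary ::
    "('k::field \<Rightarrow> 'v::ab_group_add \<Rightarrow> 'v) \<Rightarrow> ('u list \<Rightarrow> 'u) \<Rightarrow> ('v list \<Rightarrow> 'v) \<Rightarrow> ('u \<Rightarrow> 'v)
      \<Rightarrow> nat \<Rightarrow> ('u list \<Rightarrow> 'v) \<Rightarrow> ('u list \<Rightarrow> 'v)" where
  "coboundary sV \<rho> \<theta> \<Phi> p \<psi> = (\<lambda>xs.
    if p = 0 \<or> length xs \<noteq> p + 1 then 0
    else (\<Sum>s\<in>{1..p+1}. sV ((-1) ^ s) (\<theta> [\<Phi> (xs ! (s - 1)), \<psi> (omit {s} xs)]))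
       + (\<Sum>s\<in>{1..p+1}. \<Sum>t\<in>{s<..p+1}.
            sV ((-1) ^ (s + t - 1)) (\<psi> (\<rho> [xs ! (s - 1), xs ! (t - 1)] # omit {s, t} xs))))"

abbreviation lie_coboundary ::
    "('k::field \<Rightarrow> 'a::ab_group_add \<Rightarrow> 'a) \<Rightarrow> ('a list \<Rightarrow> 'a) \<Rightarrow> nat
      \<Rightarrow> ('a list \<Rightarrow> 'a) \<Rightarrow> ('a list \<Rightarrow> 'a)" where
  "lie_coboundary s \<rho> \<equiv> coboundary s \<rho> \<rho> id"

definition diamond :: "('v list \<Rightarrow> 'v) \<Rightarrow> ('u \<Rightarrow> 'v) \<Rightarrow> ('u list \<Rightarrow> 'v)"
    (infixl \<open>\<diamondop>\<close> 70) where
  "l \<diamondop> \<Phi> = (\<lambda>xs. l (map \<Phi> xs))"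

definition fun_scale :: "('k \<Rightarrow> 'b \<Rightarrow> 'b) \<Rightarrow> 'k \<Rightarrow> ('a \<Rightarrow> 'b) \<Rightarrow> ('a \<Rightarrow> 'b)" where
  "fun_scale s c f = (\<lambda>x. s c (f x))"

type_synonym ('u, 'v) cochain = "('u list \<Rightarrow> 'u) \<times> ('v list \<Rightarrow> 'v) \<times> ('u list \<Rightarrow> 'v)"

definition cochains ::
    "('k::field \<Rightarrow> 'u::ab_group_add \<Rightarrow> 'u) \<Rightarrow> ('k \<Rightarrow> 'v::ab_group_add \<Rightarrow> 'v) \<Rightarrow> nat
      \<Rightarrow> ('u, 'v) cochain set" where
  "cochains sU sV p =
    alt_maps sU sU (p + 1) \<times> alt_maps sV sV (p + 1) \<times> alt_maps sU sV p"

definition cochain_scale ::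
    "('k \<Rightarrow> 'u \<Rightarrow> 'u) \<Rightarrow> ('k \<Rightarrow> 'v \<Rightarrow> 'v) \<Rightarrow> 'k \<Rightarrow> ('u, 'v) cochain \<Rightarrow> ('u, 'v) cochain" where
  "cochain_scale sU sV c = (\<lambda>(X1, X2, X3).
    (fun_scale sU c X1, fun_scale sV c X2, fun_scale sV c X3))"

definition Delta ::
    "('k::field \<Rightarrow> 'u::ab_group_add \<Rightarrow> 'u) \<Rightarrow> ('k \<Rightarrow> 'v::ab_group_add \<Rightarrow> 'v)
      \<Rightarrow> ('u list \<Rightarrow> 'u) \<Rightarrow> ('v list \<Rightarrow> 'v) \<Rightarrow> ('u \<Rightarrow> 'v)
      \<Rightarrow> nat \<Rightarrow> ('u, 'v) cochain \<Rightarrow> ('u, 'v) cochain" where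
  "Delta sU sV \<rho> \<theta> \<Phi> p = (\<lambda>(X1, X2, X3).
    (lie_coboundary sU \<rho> (p + 1) X1,
     lie_coboundary sV \<theta> (p + 1) X2,
     coboundary sV \<rho> \<theta> \<Phi> p X3 + fun_scale sV ((-1) ^ p) ((\<Phi> \<circ> X1) - X2 \<diamondop> \<Phi>)))"

text \<open>
  A cochain complex whose terms are subspaces \<open>C p\<close> of one ambient vector space; linearity of the
  differentials is only required on the terms.
\<close>

definition cochain_complex ::
    "('k::field \<Rightarrow> 'c::ab_group_add \<Rightarrow> 'c) \<Rightarrow> (nat \<Rightarrow> 'c set) \<Rightarrow> (nat \<Rightarrow> 'c \<Rightarrow> 'c) \<Rightarrow> bool" where
  "cochain_complex s C d \<longleftrightarrow>
    vector_space s \<and>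
    (\<forall>p. module.subspace s (C p)) \<and>
    (\<forall>p. \<forall>x\<in>C p. d p x \<in> C (p + 1)) \<and>
    (\<forall>p. \<forall>x\<in>C p. \<forall>y\<in>C p. d p (x + y) = d p x + d p y) \<and>
    (\<forall>p c. \<forall>x\<in>C p. d p (s c x) = s c (d p x)) \<and>
    (\<forall>p. \<forall>x\<in>C p. d (p + 1) (d p x) = 0)"

end

theory Submission imports Defs begin

text \<open>
  For alternating cochains the coboundary is, up to sign, the operator determined by Cartan's
  formula \<open>\<iota>\<^sub>x d = L\<^sub>x - d \<iota>\<^sub>x\<close>, where \<open>\<iota>\<^sub>x\<close> inserts \<open>x\<close> as first argument and \<open>L\<^sub>x\<close> is the Lie
  derivative. Recursion on the argument list along this formula, together with
  \<open>L\<^sub>x \<iota>\<^sub>y - \<iota>\<^sub>y L\<^sub>x = \<iota>\<^bsub>[x,y]\<^esub>\<close>, gives first \<open>L\<^sub>x L\<^sub>y - L\<^sub>y L\<^sub>x = L\<^bsub>[x,y]\<^esub>\<close> from the Jacobi identity, then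
  \<open>L\<^sub>x d = d L\<^sub>x\<close>, then \<open>d d = 0\<close>. The operator \<open>\<Delta>\<close> is a mapping cone differential: its square
  vanishes because composition with \<open>\<Phi>\<close> on either side commutes with the coboundaries.
\<close>

section \<open>Alternating maps on argument lists\<close>

lemma linear_iff_add_scale:
  "Vector_Spaces.linear sA sB f \<longleftrightarrow> vector_space sA \<and> vector_space sB \<and>
    (\<forall>x y. f (x + y) = f x + f y) \<and> (\<forall>c x. f (sA c x) = sB c (f x))"
  unfolding Vector_Spaces.linear_def module_hom_iff vector_space_def module_def by auto

lemma vector_space_scale_zero: "vector_space s \<Longrightarrow> s c 0 = 0"
  by (simp add: module.scale_zero_right module_iff_vector_space)

text \<open>No arity is fixed and the value at \<open>[]\<close> is free, so the condition survives
  inserting a first argument, even when contracting a map of one argument leaves a mere constant.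
  Only adjacent repetitions are mentioned, which suits induction on lists.\<close>

definition alternating ::
    "('k::field \<Rightarrow> 'a::ab_group_add \<Rightarrow> 'a) \<Rightarrow> ('k \<Rightarrow> 'b::ab_group_add \<Rightarrow> 'b) \<Rightarrow> ('a list \<Rightarrow> 'b) \<Rightarrow> bool"
  where
  "alternating sA sB f \<longleftrightarrow>
    (\<forall>as bs. Vector_Spaces.linear sA sB (\<lambda>x. f (as @ x # bs))) \<and>
    (\<forall>as x bs. f (as @ x # x # bs) = 0)"

lemma alternating_add:
  "alternating sA sB f \<Longrightarrow> f (as @ (x + y) # bs) = f (as @ x # bs) + f (as @ y # bs)"
  unfolding alternating_def linear_iff_add_scale by blast

lemma alternating_scale:
  "alternating sA sB f \<Longrightarrow> f (as @ sA c x # bs) = sB c (f (as @ x # bs))"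
  unfolding alternating_def linear_iff_add_scale by blast

lemma alternating_repeat: "alternating sA sB f \<Longrightarrow> f (as @ x # x # bs) = 0"
  unfolding alternating_def by blast

lemma alternating_Cons: "alternating sA sB f \<Longrightarrow> alternating sA sB (\<lambda>xs. f (y # xs))"
  by (simp add: alternating_def flip: append_Cons)

lemma alternating_swap:
  assumes f: "alternating sA sB f"
  shows "f (as @ x # y # bs) = - f (as @ y # x # bs)"
proof -
  have "0 = f (as @ (x + y) # (x + y) # bs)"
    using alternating_repeat[OF f] by simp
  also have "\<dots> = f (as @ x # (x + y) # bs) + f (as @ y # (x + y) # bs)"
    using alternating_add[OF f] by simp
  also have "\<dots> = f (as @ x # y # bs) + f (as @ y # x # bs)"
    using alternating_add[OF f, of "as @ [x]" x y bs] alternating_add[OF f, of "as @ [y]" x y bs]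
      alternating_repeat[OF f, of as] by simp
  finally show ?thesis by (metis add_eq_0_iff2)
qed

text \<open>Adjacent swaps carry the first of two equal entries to the right until the two are
  neighbours; the induction runs over the segment between them.\<close>

lemma alternating_not_distinct:
  assumes f: "alternating sA sB f" and "\<not> distinct xs"
  shows "f xs = 0"
proof -
  have *: "f (as @ y # bs @ y # cs) = 0" for as y bs cs
  proof (induction bs arbitrary: as)
    case Nil
    show ?case using alternating_repeat[OF f] by simp
  next
    case (Cons b bs)
    have "f (as @ y # (b # bs) @ y # cs) = - f ((as @ [b]) @ y # bs @ y # cs)"
      using alternating_swap[OF f, of as y b "bs @ y # cs"] by simp
    with Cons.IH show ?case by (simp only: neg_equal_0_iff_equal)
  qed
  obtain as y bs cs where "xs = as @ [y] @ bs @ [y] @ cs"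
    using not_distinct_decomp[OF assms(2)] by blast
  with * show ?thesis by simp
qed

lemma linear_zero_fun:
  "vector_space sA \<Longrightarrow> vector_space sB \<Longrightarrow> Vector_Spaces.linear sA sB (\<lambda>x. 0)"
  by (simp add: linear_iff_add_scale vector_space_scale_zero)

lemma alternating_zero:
  "vector_space sA \<Longrightarrow> vector_space sB \<Longrightarrow> alternating sA sB (\<lambda>xs. 0)"
  by (simp add: alternating_def linear_zero_fun)

lemma alternating_addition:
  "alternating sA sB f \<Longrightarrow> alternating sA sB g \<Longrightarrow> alternating sA sB (\<lambda>xs. f xs + g xs)"
  by (auto simp: alternating_def linear_iff_add_scale algebra_simps vector_space.vector_space_assms(1))

lemma alternating_scaling:
  assumes "alternating sA sB f"
  shows "alternating sA sB (\<lambda>xs. sB c (f xs))"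
proof -
  have "vector_space sB"
    using assms by (auto simp: alternating_def linear_iff_add_scale)
  then interpret vector_space sB .
  show ?thesis
    using assms by (simp add: alternating_def linear_iff_add_scale scale_right_distrib mult.commute)
qed

text \<open>Bridge between fixed arity and \<open>alternating\<close>. The degree is positive
  because for \<open>p = 0\<close> the right side would admit any value at \<open>[]\<close>,
  whereas \<open>alt_maps\<close> then contains only \<open>0\<close>.\<close>

lemma mem_alt_maps_iff:
  assumes "vector_space sA" "vector_space sB" "0 < p"
  shows "f \<in> alt_maps sA sB p \<longleftrightarrow> alternating sA sB f \<and> (\<forall>xs. length xs \<noteq> p \<longrightarrow> f xs = 0)"
proof
  assume f: "f \<in> alt_maps sA sB p"
  then have zero: "f xs = 0" if "length xs \<noteq> p" for xs
    using that assms(3) by (simp add: alt_maps_def)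
  have lin: "Vector_Spaces.linear sA sB (\<lambda>x. f (as @ x # bs))" for as bs
  proof (cases "length (as @ 0 # bs) = p")
    case True
    have "length as < p" using True by simp
    \<comment> \<open>The entry \<open>0\<close> is a placeholder that the update overwrites; it
      brings the split list into the form used in \<open>alt_maps\<close>.\<close>
    then have "Vector_Spaces.linear sA sB (\<lambda>x. f ((as @ 0 # bs)[length as := x]))"
      using f assms(3) True unfolding alt_maps_def by (simp del: list_update_length)
    then show ?thesis by (simp only: list_update_length)
  next
    case False
    then have "(\<lambda>x. f (as @ x # bs)) = (\<lambda>x. 0)" using zero by auto
    then show ?thesis using linear_zero_fun assms by simp
  qed
  have "f (as @ x # x # bs) = 0" for as x bs
    using f assms(3) zero by (cases "length (as @ x # x # bs) = p") (auto simp: alt_maps_def)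
  with lin zero show "alternating sA sB f \<and> (\<forall>xs. length xs \<noteq> p \<longrightarrow> f xs = 0)"
    by (simp add: alternating_def)
next
  assume f: "alternating sA sB f \<and> (\<forall>xs. length xs \<noteq> p \<longrightarrow> f xs = 0)"
  then have "Vector_Spaces.linear sA sB (\<lambda>x. f (xs[i := x]))" if "i < length xs" for xs i
    using that by (simp add: alternating_def upd_conv_take_nth_drop)
  moreover have "f xs = 0" if "\<not> distinct xs" for xs
    using f that alternating_not_distinct by blast
  ultimately show "f \<in> alt_maps sA sB p"
    using f assms(3) by (simp add: alt_maps_def)
qed

lemma alt_mapsD_alternating:
  assumes "vector_space sA" "vector_space sB" "f \<in> alt_maps sA sB p"
  shows "alternating sA sB f"
proof (cases "p = 0")
  case True
  with assms(3) have "f = (\<lambda>xs. 0)" by (simp add: alt_maps_def zero_fun_def)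
  with assms(1,2) show ?thesis by (simp only: alternating_zero)
qed (use assms mem_alt_maps_iff in blast)

lemma alt_maps_length: "f \<in> alt_maps sA sB p \<Longrightarrow> length xs \<noteq> p \<Longrightarrow> f xs = 0"
  by (auto simp: alt_maps_def split: if_splits)

section \<open>Linear structure and functoriality of the spaces of alternating maps\<close>

lemma zero_in_alt_maps:
  "vector_space sA \<Longrightarrow> vector_space sB \<Longrightarrow> 0 \<in> alt_maps sA sB p"
  using mem_alt_maps_iff[of sA sB p 0] alternating_zero[of sA sB]
  by (cases "p = 0") (simp_all add: alt_maps_def zero_fun_def)

lemma add_in_alt_maps:
  assumes "vector_space sA" "vector_space sB" "f \<in> alt_maps sA sB p" "g \<in> alt_maps sA sB p"
  shows "f + g \<in> alt_maps sA sB p"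
proof (cases "p = 0")
  case False
  then show ?thesis
    using assms alternating_addition[of sA sB f g] by (simp add: mem_alt_maps_iff plus_fun_def)
qed (use assms in \<open>simp add: alt_maps_def\<close>)

lemma scale_in_alt_maps:
  assumes "vector_space sA" "vector_space sB" "f \<in> alt_maps sA sB p"
  shows "fun_scale sB c f \<in> alt_maps sA sB p"
proof (cases "p = 0")
  case True
  then show ?thesis
    using assms by (auto simp: alt_maps_def fun_scale_def vector_space_scale_zero)
next
  case False
  then show ?thesis
    using assms alternating_scaling[of sA sB f c]
    by (simp add: mem_alt_maps_iff fun_scale_def vector_space_scale_zero)
qed

lemma diff_in_alt_maps:
  assumes "vector_space sA" "vector_space sB" "f \<in> alt_maps sA sB p" "g \<in> alt_maps sA sB p"
  shows "f - g \<in> alt_maps sA sB p"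
proof -
  interpret vector_space sB by fact
  have "f - g = f + fun_scale sB (-1) g"
    by (simp add: fun_scale_def fun_eq_iff)
  then show ?thesis
    using add_in_alt_maps[OF assms(1-3) scale_in_alt_maps[OF assms(1,2,4)]] by (simp only:)
qed

lemma comp_in_alt_maps:
  assumes \<Phi>: "Vector_Spaces.linear sB sC \<Phi>" and f: "f \<in> alt_maps sA sB p" and "vector_space sA"
  shows "\<Phi> \<circ> f \<in> alt_maps sA sC p"
proof -
  interpret Vector_Spaces.linear sB sC \<Phi> by fact
  have vs: "vector_space sB" "vector_space sC" by unfold_locales
  show ?thesis
  proof (cases "p = 0")
    case True
    then show ?thesis using f by (auto simp: alt_maps_def zero)
  next
    case False
    have "alternating sA sC (\<Phi> \<circ> f)"
      using alt_mapsD_alternating[OF \<open>vector_space sA\<close> vs(1) f] vs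
      by (simp add: alternating_def linear_iff_add_scale add scale zero)
    with False show ?thesis
      using f assms(3) vs by (simp add: mem_alt_maps_iff zero)
  qed
qed

lemma diamond_in_alt_maps:
  assumes \<Phi>: "Vector_Spaces.linear sA sB \<Phi>" and f: "f \<in> alt_maps sB sC p" and "vector_space sC"
  shows "f \<diamondop> \<Phi> \<in> alt_maps sA sC p"
proof -
  interpret Vector_Spaces.linear sA sB \<Phi> by fact
  have vs: "vector_space sA" "vector_space sB" by unfold_locales
  show ?thesis
  proof (cases "p = 0")
    case True
    then show ?thesis using f by (auto simp: alt_maps_def diamond_def)
  next
    case False
    have "alternating sA sC (f \<diamondop> \<Phi>)"
      using alt_mapsD_alternating[OF vs(2) \<open>vector_space sC\<close> f] vs
      by (simp add: alternating_def linear_iff_add_scale add scale diamond_def)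
    with False show ?thesis
      using f assms(3) vs by (simp add: mem_alt_maps_iff diamond_def)
  qed
qed

text \<open>Positions are 1-based, so passing to the tail shifts the omitted set by one, and
  \<open>0\<close> in \<open>S\<close> stands for the head. Keeping \<open>0\<close> in the set on
  the right is harmless, as no entry has position \<open>0\<close>.\<close>

lemma omit_image_Suc_Cons:
  "omit (Suc ` S) (x # xs) = (if 0 \<in> S then omit S xs else x # omit S xs)"
  by (simp add: omit_def nths_Cons inj_image_mem_iff)

lemma omit_1_Cons: "omit {Suc 0} (x # xs) = xs"
  using omit_image_Suc_Cons[of "{0}" x xs] by (simp add: omit_def nths_all)

lemma omit_Suc_Cons: "0 < s \<Longrightarrow> omit {Suc s} (x # xs) = x # omit {s} xs"
  using omit_image_Suc_Cons[of "{s}" x xs] by simp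

lemma omit_1_Suc_Cons: "omit {Suc 0, Suc t} (x # xs) = omit {t} xs"
  using omit_image_Suc_Cons[of "{0, t}" x xs] by (simp add: omit_def)

lemma omit_Suc_Suc_Cons:
  "0 < s \<Longrightarrow> 0 < t \<Longrightarrow> omit {Suc s, Suc t} (x # xs) = x # omit {s, t} xs"
  using omit_image_Suc_Cons[of "{s, t}" x xs] by simp

section \<open>Cartan calculus of a Lie algebra morphism\<close>

text \<open>Set up for a morphism and finally instantiated three times, with \<open>\<Phi>\<close>
  and with the two identity maps, so that one calculus serves all three coboundaries.\<close>

locale lie_hom =
  fixes sU :: "'k::field \<Rightarrow> 'u::ab_group_add \<Rightarrow> 'u"
    and sV :: "'k \<Rightarrow> 'v::ab_group_add \<Rightarrow> 'v"
    and \<rho> :: "'u list \<Rightarrow> 'u"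
    and \<theta> :: "'v list \<Rightarrow> 'v"
    and \<Phi> :: "'u \<Rightarrow> 'v"
  assumes vector_space_U: "vector_space sU"
    and vector_space_V: "vector_space sV"
    and lie_U: "lie_structure sU \<rho>"
    and lie_V: "lie_structure sV \<theta>"
    and morphism: "lie_morphism sU sV \<rho> \<theta> \<Phi>"
begin

sublocale U: vector_space sU by (rule vector_space_U)
sublocale V: vector_space sV by (rule vector_space_V)
sublocale \<Phi>: Vector_Spaces.linear sU sV \<Phi>
  using morphism by (simp add: lie_morphism_def)

abbreviation br :: "'u \<Rightarrow> 'u \<Rightarrow> 'u" where "br x y \<equiv> \<rho> [x, y]"
abbreviation act :: "'u \<Rightarrow> 'v \<Rightarrow> 'v" where "act x v \<equiv> \<theta> [\<Phi> x, v]"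

lemma alternating_\<rho>: "alternating sU sU \<rho>"
  using lie_U alt_mapsD_alternating vector_space_U by (auto simp: lie_structure_def)

lemma alternating_\<theta>: "alternating sV sV \<theta>"
  using lie_V alt_mapsD_alternating vector_space_V by (auto simp: lie_structure_def)

lemma br_simps:
  "br (x + y) z = br x z + br y z" "br z (x + y) = br z x + br z y"
  "br (sU c x) z = sU c (br x z)" "br z (sU c x) = sU c (br z x)" "br x x = 0"
  using alternating_add[OF alternating_\<rho>, of "[]" x y "[z]"]
    alternating_add[OF alternating_\<rho>, of "[z]" x y "[]"]
    alternating_scale[OF alternating_\<rho>, of "[]" c x "[z]"]
    alternating_scale[OF alternating_\<rho>, of "[z]" c x "[]"]
    alternating_repeat[OF alternating_\<rho>, of "[]" x "[]"] by simp_all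

lemma br_swap: "br x y = - br y x"
  by (rule alternating_swap[OF alternating_\<rho>, of "[]" x y "[]", unfolded append_Nil])

lemma \<theta>_simps:
  "\<theta> [v + w, u] = \<theta> [v, u] + \<theta> [w, u]" "\<theta> [u, v + w] = \<theta> [u, v] + \<theta> [u, w]"
  "\<theta> [sV c v, u] = sV c (\<theta> [v, u])" "\<theta> [u, sV c v] = sV c (\<theta> [u, v])"
  using alternating_add[OF alternating_\<theta>, of "[]" v w "[u]"]
    alternating_add[OF alternating_\<theta>, of "[u]" v w "[]"]
    alternating_scale[OF alternating_\<theta>, of "[]" c v "[u]"]
    alternating_scale[OF alternating_\<theta>, of "[u]" c v "[]"] by simp_all

lemma \<theta>_swap: "\<theta> [v, w] = - \<theta> [w, v]"
  by (rule alternating_swap[OF alternating_\<theta>, of "[]" v w "[]", unfolded append_Nil])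

lemma \<theta>_minus: "\<theta> [u, - v] = - \<theta> [u, v]"
  using \<theta>_simps(4)[of u "-1" v] by simp

lemma \<rho>_minus: "br x (- y) = - br x y"
  using br_simps(4)[of x "-1" y] by simp

lemma act_simps:
  "act (x + y) v = act x v + act y v" "act x (v + w) = act x v + act x w"
  "act (sU c x) v = sV c (act x v)" "act x (sV c v) = sV c (act x v)"
  "act x 0 = 0" "act x (- v) = - act x v" "act x (v - w) = act x v - act x w"
  using \<theta>_simps(4)[of "\<Phi> x" 0 0] \<theta>_simps(2)[of "\<Phi> x" v "- w"]
  by (simp_all add: \<theta>_simps \<Phi>.add \<Phi>.scale \<theta>_minus)

text \<open>Skew symmetry moves the outer brackets into adjoint form, the shape in which nested
  brackets arise from commutators of Lie derivatives.\<close>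

lemma jacobi: "br x (br y z) - br y (br x z) = br (br x y) z"
proof -
  have "br (br x y) z + br (br y z) x + br (br z x) y = 0"
    using lie_U by (simp add: lie_structure_def)
  moreover have "br (br y z) x = - br x (br y z)" "br (br z x) y = br y (br x z)"
    using br_swap[of "br y z" x] br_swap[of "br z x" y] br_swap[of z x] \<rho>_minus by simp_all
  ultimately show ?thesis by (simp add: algebra_simps)
qed

text \<open>This is the Jacobi identity of \<open>\<theta>\<close> at \<open>\<Phi> x\<close>,
  \<open>\<Phi> y\<close>, \<open>v\<close>. It makes the target a representation of the source Lie
  algebra, the coefficient module of the cochains.\<close>

lemma act_br: "act (br x y) v = act x (act y v) - act y (act x v)"
proof -
  have "act (br x y) v = \<theta> [\<theta> [\<Phi> x, \<Phi> y], v]"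
    using morphism by (simp add: lie_morphism_def)
  moreover have "\<theta> [\<theta> [\<Phi> x, \<Phi> y], v] + \<theta> [act y v, \<Phi> x] + \<theta> [\<theta> [v, \<Phi> x], \<Phi> y] = 0"
    using lie_V by (simp add: lie_structure_def)
  moreover have "\<theta> [act y v, \<Phi> x] = - act x (act y v)" "\<theta> [\<theta> [v, \<Phi> x], \<Phi> y] = act y (act x v)"
    using \<theta>_swap[of "act y v" "\<Phi> x"] \<theta>_swap[of "\<theta> [v, \<Phi> x]" "\<Phi> y"] \<theta>_swap[of v "\<Phi> x"] \<theta>_minus
    by simp_all
  ultimately show ?thesis by (simp add: algebra_simps)
qed

text \<open>Unrolled: the action of \<open>x\<close> on the value of \<open>f\<close>, minus the sum
  of the values of \<open>f\<close> with one argument \<open>y\<close> replaced by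
  \<open>br x y\<close>.\<close>

primrec lie_deriv :: "'u \<Rightarrow> ('u list \<Rightarrow> 'v) \<Rightarrow> 'u list \<Rightarrow> 'v" where
  "lie_deriv x f [] = act x (f [])"
| "lie_deriv x f (y # ys) = lie_deriv x (\<lambda>zs. f (y # zs)) ys - f (br x y # ys)"

text \<open>On a single argument this is \<open>act x (f [])\<close>, the Chevalley-Eilenberg
  differential of a constant. The recursion relies on that value, since contracting a 1-cochain
  produces a constant.\<close>

primrec cartan_diff :: "('u list \<Rightarrow> 'v) \<Rightarrow> 'u list \<Rightarrow> 'v" where
  "cartan_diff f [] = 0"
| "cartan_diff f (x # xs) = lie_deriv x f xs - cartan_diff (\<lambda>zs. f (x # zs)) xs"

lemma lie_deriv_add: "lie_deriv x (\<lambda>zs. f zs + g zs) ys = lie_deriv x f ys + lie_deriv x g ys"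
  by (induction ys arbitrary: f g) (simp_all add: act_simps)

lemma lie_deriv_diff: "lie_deriv x (\<lambda>zs. f zs - g zs) ys = lie_deriv x f ys - lie_deriv x g ys"
  by (induction ys arbitrary: f g) (simp_all add: act_simps)

lemma lie_deriv_scale: "lie_deriv x (\<lambda>zs. sV c (f zs)) ys = sV c (lie_deriv x f ys)"
  by (induction ys arbitrary: f) (simp_all add: act_simps V.scale_right_diff_distrib)

lemma cartan_diff_add: "cartan_diff (\<lambda>zs. f zs + g zs) ys = cartan_diff f ys + cartan_diff g ys"
  by (induction ys arbitrary: f g) (simp_all add: lie_deriv_add)

lemma cartan_diff_diff: "cartan_diff (\<lambda>zs. f zs - g zs) ys = cartan_diff f ys - cartan_diff g ys"
  by (induction ys arbitrary: f g) (simp_all add: lie_deriv_diff)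

lemma cartan_diff_scale: "cartan_diff (\<lambda>zs. sV c (f zs)) ys = sV c (cartan_diff f ys)"
  by (induction ys arbitrary: f) (simp_all add: lie_deriv_scale V.scale_right_diff_distrib)

lemma lie_deriv_eq_zero:
  "(\<And>ys. length ys = length xs \<Longrightarrow> f ys = 0) \<Longrightarrow> lie_deriv x f xs = 0"
  by (induction xs arbitrary: f) (simp_all add: act_simps)

lemma cartan_diff_eq_zero:
  "(\<And>ys. Suc (length ys) = length xs \<Longrightarrow> f ys = 0) \<Longrightarrow> cartan_diff f xs = 0"
  by (induction xs arbitrary: f) (simp_all add: lie_deriv_eq_zero)

context
  fixes f :: "'u list \<Rightarrow> 'v"
  assumes f: "alternating sU sV f"
begin

lemma alternating_head_add: "f ((x + y) # zs) = f (x # zs) + f (y # zs)"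
  using alternating_add[OF f, of "[]"] by simp

lemma alternating_head_scale: "f (sU c x # zs) = sV c (f (x # zs))"
  using alternating_scale[OF f, of "[]"] by simp

lemma alternating_head_zero: "f (0 # zs) = 0"
  using alternating_head_scale[of 0 0 zs] by simp

lemma alternating_head_diff: "f ((x - y) # zs) = f (x # zs) - f (y # zs)"
  using alternating_head_add[of "x - y" y zs] by simp

lemma alternating_head_repeat: "f (x # x # zs) = 0"
  using alternating_repeat[OF f, of "[]"] by simp

lemma alternating_head_swap: "f (x # y # zs) = - f (y # x # zs)"
  by (rule alternating_swap[OF f, of "[]", unfolded append_Nil])

end

section \<open>Preservation of alternating maps by the Lie derivative and the differential\<close>

lemma lie_deriv_add_left:
  "alternating sU sV f \<Longrightarrow> lie_deriv (x + y) f zs = lie_deriv x f zs + lie_deriv y f zs"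
proof (induction zs arbitrary: f)
  case (Cons z zs)
  then show ?case
    by (simp add: br_simps alternating_head_add[OF Cons.prems] alternating_Cons[OF Cons.prems])
qed (simp add: act_simps)

lemma lie_deriv_scale_left:
  "alternating sU sV f \<Longrightarrow> lie_deriv (sU c x) f zs = sV c (lie_deriv x f zs)"
proof (induction zs arbitrary: f)
  case (Cons z zs)
  then show ?case
    by (simp add: br_simps alternating_head_scale[OF Cons.prems] alternating_Cons[OF Cons.prems]
        V.scale_right_diff_distrib)
qed (simp add: act_simps)

lemma alternatingI:
  assumes "\<And>as x y bs. f (as @ (x + y) # bs) = f (as @ x # bs) + f (as @ y # bs)"
    and "\<And>as c x bs. f (as @ sU c x # bs) = sV c (f (as @ x # bs))"
    and "\<And>as x bs. f (as @ x # x # bs) = 0"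
  shows "alternating sU sV f"
  using assms vector_space_U vector_space_V by (simp add: alternating_def linear_iff_add_scale)

text \<open>Induction on the entries in front of the slot in question: contraction with such an
  entry \<open>a\<close> keeps \<open>f\<close> alternating, and the correction term is
  \<open>f\<close> itself with \<open>br x a\<close> in the prefix. Only a slot at the head needs
  computation.\<close>

lemma alternating_lie_deriv:
  assumes "alternating sU sV f"
  shows "alternating sU sV (lie_deriv x f)"
proof (rule alternatingI)
  show "lie_deriv x f (as @ (y + z) # bs) = lie_deriv x f (as @ y # bs) + lie_deriv x f (as @ z # bs)"
    for as y z bs
    using assms
  proof (induction as arbitrary: f)
    case Nil
    then show ?case
      by (simp add: br_simps alternating_head_add[OF Nil] lie_deriv_add)
  next
    case (Cons a as)
    then show ?case
      using alternating_add[OF Cons.prems, of "br x a # as" y z bs]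
      by (simp add: alternating_Cons[OF Cons.prems])
  qed
  show "lie_deriv x f (as @ sU c y # bs) = sV c (lie_deriv x f (as @ y # bs))" for as c y bs
    using assms
  proof (induction as arbitrary: f)
    case Nil
    then show ?case
      by (simp add: br_simps alternating_head_scale[OF Nil] lie_deriv_scale V.scale_right_diff_distrib)
  next
    case (Cons a as)
    then show ?case
      using alternating_scale[OF Cons.prems, of "br x a # as" c y bs]
      by (simp add: alternating_Cons[OF Cons.prems] V.scale_right_diff_distrib)
  qed
  show "lie_deriv x f (as @ y # y # bs) = 0" for as y bs
    using assms
  proof (induction as arbitrary: f)
    case Nil
    \<comment> \<open>The contraction \<open>f (y # y # zs)\<close> is zero, and the two terms with
      \<open>y\<close> and \<open>br x y\<close> in either order cancel by skew symmetry.\<close>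
    then show ?case
      using alternating_head_swap[OF Nil, of y "br x y" bs]
      by (simp add: alternating_head_repeat[OF Nil] lie_deriv_eq_zero)
  next
    case (Cons a as)
    then show ?case
      using alternating_repeat[OF Cons.prems, of "br x a # as" y bs]
      by (simp add: alternating_Cons[OF Cons.prems])
  qed
qed

lemma alternating_cartan_diff:
  assumes "alternating sU sV f"
  shows "alternating sU sV (cartan_diff f)"
proof (rule alternatingI)
  show "cartan_diff f (as @ (y + z) # bs) = cartan_diff f (as @ y # bs) + cartan_diff f (as @ z # bs)"
    for as y z bs
    using assms
  proof (induction as arbitrary: f)
    case Nil
    then show ?case
      by (simp add: alternating_head_add[OF Nil] cartan_diff_add lie_deriv_add_left[OF Nil])
  next
    case (Cons a as)
    then show ?case
      using alternating_add[OF alternating_lie_deriv[OF Cons.prems], of a as y z bs]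
      by (simp add: alternating_Cons[OF Cons.prems])
  qed
  show "cartan_diff f (as @ sU c y # bs) = sV c (cartan_diff f (as @ y # bs))" for as c y bs
    using assms
  proof (induction as arbitrary: f)
    case Nil
    then show ?case
      by (simp add: alternating_head_scale[OF Nil] cartan_diff_scale lie_deriv_scale_left[OF Nil]
          V.scale_right_diff_distrib)
  next
    case (Cons a as)
    then show ?case
      using alternating_scale[OF alternating_lie_deriv[OF Cons.prems], of a as c y bs]
      by (simp add: alternating_Cons[OF Cons.prems] V.scale_right_diff_distrib)
  qed
  show "cartan_diff f (as @ y # y # bs) = 0" for as y bs
    using assms
  proof (induction as arbitrary: f)
    case Nil
    \<comment> \<open>The two Lie derivatives along \<open>y\<close> of the contracted map cancel.
      What is left is \<open>f\<close> with head \<open>br y y = 0\<close> and the differential of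
      the zero map \<open>f (y # y # zs)\<close>.\<close>
    then show ?case
      by (simp add: br_simps alternating_head_zero[OF Nil] alternating_head_repeat[OF Nil] cartan_diff_eq_zero)
  next
    case (Cons a as)
    then show ?case
      using alternating_repeat[OF alternating_lie_deriv[OF Cons.prems], of a as y bs]
      by (simp add: alternating_Cons[OF Cons.prems])
  qed
qed

text \<open>The base case is the representation property. After contraction with \<open>z\<close>,
  the mixed terms with a single Lie derivative cancel in the commutator, and the nested brackets
  match by Jacobi.\<close>

lemma lie_deriv_br:
  "alternating sU sV f \<Longrightarrow>
    lie_deriv (br x y) f zs = lie_deriv x (lie_deriv y f) zs - lie_deriv y (lie_deriv x f) zs"
proof (induction zs arbitrary: f)
  case Nil
  show ?case by (simp add: act_br)
next
  case (Cons z zs)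
  have "f (br (br x y) z # zs) = f (br x (br y z) # zs) - f (br y (br x z) # zs)"
    by (simp only: alternating_head_diff[OF Cons.prems] flip: jacobi)
  then show ?case
    using Cons by (simp add: lie_deriv_diff alternating_Cons[OF Cons.prems])
qed

text \<open>After contraction with \<open>z\<close> the two sides differ by the commutator of the
  derivatives along \<open>x\<close> and \<open>z\<close> minus the derivative along
  \<open>br x z\<close>, which is zero, and by the same claim for the contracted map.\<close>

lemma lie_deriv_cartan_diff:
  "alternating sU sV f \<Longrightarrow> lie_deriv x (cartan_diff f) zs = cartan_diff (lie_deriv x f) zs"
proof (induction zs arbitrary: f)
  case Nil
  show ?case by (simp add: act_simps)
next
  case (Cons z zs)
  then show ?case
    by (simp add: lie_deriv_diff cartan_diff_diff lie_deriv_br[OF Cons.prems] alternating_Cons[OF Cons.prems])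
qed

text \<open>Contraction with \<open>z\<close> turns the square into the commutator of Lie derivative
  and differential plus the square on the contracted map; both vanish.\<close>

lemma cartan_diff_cartan_diff:
  "alternating sU sV f \<Longrightarrow> cartan_diff (cartan_diff f) zs = 0"
proof (induction zs arbitrary: f)
  case (Cons z zs)
  then show ?case
    by (simp add: cartan_diff_diff lie_deriv_cartan_diff[OF Cons.prems]
        alternating_Cons[OF Cons.prems])
qed simp

section \<open>The coboundary as Cartan differential\<close>

lemma sum_atLeast1_Suc: "(\<Sum>i\<in>{1..Suc n}. g i) = g 1 + (\<Sum>i\<in>{1..n}. g (Suc i))"
  for g :: "nat \<Rightarrow> 'v"
  by (simp add: sum.atLeast_Suc_atMost sum.shift_bounds_cl_Suc_ivl del: sum.cl_ivl_Suc)

lemma sum_greaterThan_Suc: "(\<Sum>i\<in>{Suc m<..Suc n}. g i) = (\<Sum>i\<in>{m<..n}. g (Suc i))"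
  for g :: "nat \<Rightarrow> 'v"
  by (simp add: sum.shift_bounds_cl_Suc_ivl flip: atLeastSucAtMost_greaterThanAtMost
      del: sum.cl_ivl_Suc)

text \<open>The recursion leaves \<open>br x y\<close> in the place of the \<open>t\<close>-th entry
  \<open>y\<close>, whereas the coboundary wants it in front. Moving it past \<open>t - 1\<close>
  entries and the minus sign of the recursion combine to \<open>(-1) ^ t\<close>.\<close>

lemma lie_deriv_eq_sum:
  "alternating sU sV f \<Longrightarrow> lie_deriv x f ys = act x (f ys) +
    (\<Sum>t\<in>{1..length ys}. sV ((-1) ^ t) (f (br x (ys ! (t - 1)) # omit {t} ys)))"
proof (induction ys arbitrary: f)
  case Nil
  show ?case by simp
next
  case (Cons y ys)
  let ?g = "\<lambda>t. sV ((-1) ^ t) (f (br x ((y # ys) ! (t - 1)) # omit {t} (y # ys)))"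
  have "?g (Suc t) = sV ((-1) ^ t) (f (y # br x (ys ! (t - 1)) # omit {t} ys))" if "1 \<le> t" for t
    using that alternating_head_swap[OF Cons.prems, of "br x (ys ! (t - 1))" y]
    by (simp add: omit_Suc_Cons nth_Cons')
  then have "(\<Sum>t\<in>{1..length ys}. ?g (Suc t)) =
      (\<Sum>t\<in>{1..length ys}. sV ((-1) ^ t) (f (y # br x (ys ! (t - 1)) # omit {t} ys)))"
    by (intro sum.cong) auto
  moreover have "?g 1 = - f (br x y # ys)"
    by (simp add: omit_1_Cons)
  ultimately show ?case
    using Cons unfolding length_Cons sum_atLeast1_Suc by (simp add: alternating_Cons[OF Cons.prems])
qed

text \<open>
  Splitting off the terms with \<open>s = 1\<close> in both sums leaves \<open>- L\<^sub>x f\<close>; in the remaining terms of the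
  second sum \<open>x\<close> has to be moved in front of the bracket, which accounts for the sign in
  Cartan's formula.
\<close>

lemma cartan_diff_eq_sum:
  "alternating sU sV f \<Longrightarrow> - cartan_diff f xs =
    (\<Sum>s\<in>{1..length xs}. sV ((-1) ^ s) (act (xs ! (s - 1)) (f (omit {s} xs)))) +
    (\<Sum>s\<in>{1..length xs}. \<Sum>t\<in>{s<..length xs}.
      sV ((-1) ^ (s + t - 1)) (f (br (xs ! (s - 1)) (xs ! (t - 1)) # omit {s, t} xs)))"
proof (induction xs arbitrary: f)
  case Nil
  show ?case by simp
next
  case (Cons x xs)
  let ?n = "length xs"
  let ?a = "\<lambda>s. sV ((-1) ^ s) (act ((x # xs) ! (s - 1)) (f (omit {s} (x # xs))))"
  let ?b = "\<lambda>s t. sV ((-1) ^ (s + t - 1))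
    (f (br ((x # xs) ! (s - 1)) ((x # xs) ! (t - 1)) # omit {s, t} (x # xs)))"
  let ?a' = "\<lambda>s. sV ((-1) ^ s) (act (xs ! (s - 1)) (f (x # omit {s} xs)))"
  let ?b' = "\<lambda>s t. sV ((-1) ^ (s + t - 1))
    (f (x # br (xs ! (s - 1)) (xs ! (t - 1)) # omit {s, t} xs))"
  \<comment> \<open>Shifting indices raises the exponent by one in the first sum, which flips its
    sign, but by two in the double sum, where the flip has to come from skew symmetry.\<close>
  have "?a (Suc s) = - ?a' s" if "1 \<le> s" for s
    using that by (simp add: omit_Suc_Cons nth_Cons')
  then have a: "(\<Sum>s\<in>{1..?n}. ?a (Suc s)) = - (\<Sum>s\<in>{1..?n}. ?a' s)"
    unfolding sum_negf[symmetric] by (intro sum.cong) auto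
  have a1: "?a 1 = - act x (f xs)"
    by (simp add: omit_1_Cons)
  have "?b (Suc s) (Suc t) = - ?b' s t" if "1 \<le> s" "s < t" for s t
    using that alternating_head_swap[OF Cons.prems, of "br (xs ! (s - 1)) (xs ! (t - 1))" x]
    by (cases s; cases t) (simp_all add: omit_Suc_Suc_Cons)
  then have b: "(\<Sum>s\<in>{1..?n}. \<Sum>t\<in>{s<..?n}. ?b (Suc s) (Suc t)) =
      - (\<Sum>s\<in>{1..?n}. \<Sum>t\<in>{s<..?n}. ?b' s t)"
    unfolding sum_negf[symmetric] by (intro sum.cong) auto
  have "?b 1 (Suc t) = - sV ((-1) ^ t) (f (br x (xs ! (t - 1)) # omit {t} xs))" if "0 < t" for t
    using that by (simp add: omit_1_Suc_Cons nth_Cons')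
  then have b1: "(\<Sum>t\<in>{0<..?n}. ?b 1 (Suc t)) =
      - (\<Sum>t\<in>{1..?n}. sV ((-1) ^ t) (f (br x (xs ! (t - 1)) # omit {t} xs)))"
    unfolding sum_negf[symmetric] by (intro sum.cong) auto
  have rearrange: "- u + - v + (- w + - z) = - (u + w) - (v + z)" for u v w z :: 'v
    by (simp add: algebra_simps)
  \<comment> \<open>The row \<open>s = 1\<close> has \<open>t\<close> starting at 2; after the shift
    its range is that of the sum for the Lie derivative.\<close>
  have b0: "(\<Sum>t\<in>{1<..Suc ?n}. ?b 1 t) = (\<Sum>t\<in>{0<..?n}. ?b 1 (Suc t))"
    unfolding One_nat_def by (rule sum_greaterThan_Suc)
  have "(\<Sum>s\<in>{1..Suc ?n}. ?a s) + (\<Sum>s\<in>{1..Suc ?n}. \<Sum>t\<in>{s<..Suc ?n}. ?b s t) =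
      ?a 1 + (\<Sum>s\<in>{1..?n}. ?a (Suc s)) +
      ((\<Sum>t\<in>{0<..?n}. ?b 1 (Suc t)) + (\<Sum>s\<in>{1..?n}. \<Sum>t\<in>{s<..?n}. ?b (Suc s) (Suc t)))"
    unfolding sum_atLeast1_Suc b0 sum_greaterThan_Suc ..
  also have "\<dots> = - lie_deriv x f xs -
      ((\<Sum>s\<in>{1..?n}. ?a' s) + (\<Sum>s\<in>{1..?n}. \<Sum>t\<in>{s<..?n}. ?b' s t))"
    unfolding a a1 b b1 lie_deriv_eq_sum[OF Cons.prems] by (rule rearrange)
  also have "\<dots> = - cartan_diff f (x # xs)"
    using Cons.IH[OF alternating_Cons[OF Cons.prems, of x], symmetric] by simp
  finally show ?case unfolding length_Cons ..
qed

lemma coboundary_eq_cartan_diff: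
  assumes "f \<in> alt_maps sU sV p" "0 < p"
  shows "coboundary sV \<rho> \<theta> \<Phi> p f = (\<lambda>xs. - cartan_diff f xs)"
proof
  fix xs
  show "coboundary sV \<rho> \<theta> \<Phi> p f xs = - cartan_diff f xs"
  proof (cases "length xs = p + 1")
    case True
    then show ?thesis
      using assms cartan_diff_eq_sum[of f xs] alt_mapsD_alternating[OF vector_space_U vector_space_V]
      by (simp add: coboundary_def)
  next
    case False
    \<comment> \<open>The differential at \<open>xs\<close> consults \<open>f\<close> only on lists
      one entry shorter, and \<open>f\<close> vanishes there.\<close>
    then have "cartan_diff f xs = 0"
      using alt_maps_length[OF assms(1)] by (intro cartan_diff_eq_zero) auto
    with False show ?thesis by (simp add: coboundary_def)
  qed
qed

lemma coboundary_in_alt_maps: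
  assumes "f \<in> alt_maps sU sV p"
  shows "coboundary sV \<rho> \<theta> \<Phi> p f \<in> alt_maps sU sV (p + 1)"
proof (cases "p = 0")
  case True
  then have "coboundary sV \<rho> \<theta> \<Phi> p f = 0"
    by (auto simp: coboundary_def)
  then show ?thesis
    using zero_in_alt_maps vector_space_U vector_space_V by metis
next
  case False
  have "alternating sU sV (\<lambda>xs. sV (-1) (cartan_diff f xs))"
    using assms alt_mapsD_alternating vector_space_U vector_space_V
    by (intro alternating_scaling alternating_cartan_diff) blast
  then have "alternating sU sV (coboundary sV \<rho> \<theta> \<Phi> p f)"
    using coboundary_eq_cartan_diff assms False by simp
  moreover have "coboundary sV \<rho> \<theta> \<Phi> p f xs = 0" if "length xs \<noteq> p + 1" for xs
    using that by (simp add: coboundary_def)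
  ultimately show ?thesis
    by (simp add: mem_alt_maps_iff vector_space_U vector_space_V)
qed

lemma coboundary_coboundary:
  assumes "f \<in> alt_maps sU sV p"
  shows "coboundary sV \<rho> \<theta> \<Phi> (p + 1) (coboundary sV \<rho> \<theta> \<Phi> p f) = 0"
proof (cases "p = 0")
  case True
  then have "coboundary sV \<rho> \<theta> \<Phi> p f = (\<lambda>xs. 0)"
    by (auto simp: coboundary_def)
  then show ?thesis
    using act_simps(5) by (auto simp: coboundary_def)
next
  case False
  have alt: "alternating sU sV f"
    using assms alt_mapsD_alternating vector_space_U vector_space_V by blast
  have "coboundary sV \<rho> \<theta> \<Phi> (p + 1) (coboundary sV \<rho> \<theta> \<Phi> p f)
      = (\<lambda>xs. - cartan_diff (\<lambda>ys. - cartan_diff f ys) xs)"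
    using coboundary_eq_cartan_diff[OF coboundary_in_alt_maps[OF assms]]
      coboundary_eq_cartan_diff[OF assms] False by simp
  \<comment> \<open>The two minus signs cancel, as the differential commutes with the scalar
    \<open>-1\<close>.\<close>
  also have "\<dots> = (\<lambda>xs. cartan_diff (cartan_diff f) xs)"
    using cartan_diff_scale[of "-1" "cartan_diff f"] by simp
  finally show ?thesis
    using cartan_diff_cartan_diff[OF alt] by auto
qed

section \<open>Linearity of the coboundary and compatibility with the morphism\<close>

lemma coboundary_add:
  "coboundary sV \<rho> \<theta> \<Phi> p (f + g) = coboundary sV \<rho> \<theta> \<Phi> p f + coboundary sV \<rho> \<theta> \<Phi> p g"
  by (auto simp: coboundary_def act_simps V.scale_right_distrib sum.distrib)

lemma coboundary_scale:
  "coboundary sV \<rho> \<theta> \<Phi> p (fun_scale sV c f) = fun_scale sV c (coboundary sV \<rho> \<theta> \<Phi> p f)"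
  by (rule ext) (simp add: coboundary_def fun_scale_def act_simps V.scale_right_distrib
      V.scale_sum_right mult.commute del: sum.cl_ivl_Suc)

text \<open>Linearity lets \<open>\<Phi>\<close> pass through the sums, and the morphism property
  turns \<open>\<rho>\<close> into \<open>\<theta>\<close> in the action terms. Thus composing with
  \<open>\<Phi>\<close> after a cochain is a chain map.\<close>

lemma coboundary_comp: "coboundary sV \<rho> \<theta> \<Phi> p (\<Phi> \<circ> f) = \<Phi> \<circ> lie_coboundary sU \<rho> p f"
proof -
  have "\<Phi> (br x y) = \<theta> [\<Phi> x, \<Phi> y]" for x y
    using morphism by (simp add: lie_morphism_def)
  then show ?thesis
    by (intro ext) (simp add: coboundary_def \<Phi>.zero \<Phi>.add \<Phi>.scale \<Phi>.sum del: sum.cl_ivl_Suc)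
qed

text \<open>Omission of positions commutes with \<open>map \<Phi>\<close>, and brackets of images
  are images of brackets, so substituting \<open>\<Phi>\<close> into the arguments is a chain map as
  well.\<close>

lemma coboundary_diamond: "coboundary sV \<rho> \<theta> \<Phi> p (f \<diamondop> \<Phi>) = lie_coboundary sV \<theta> p f \<diamondop> \<Phi>"
proof
  fix xs
  have "\<Phi> (br x y) = \<theta> [\<Phi> x, \<Phi> y]" for x y
    using morphism by (simp add: lie_morphism_def)
  moreover have "map \<Phi> (omit S xs) = omit S (map \<Phi> xs)" for S
    by (simp add: omit_def nths_map)
  ultimately show "coboundary sV \<rho> \<theta> \<Phi> p (f \<diamondop> \<Phi>) xs = (lie_coboundary sV \<theta> p f \<diamondop> \<Phi>) xs"
    by (auto simp: coboundary_def diamond_def intro!: arg_cong2[where f = "(+)"] sum.cong)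
qed

end

section \<open>The complex of a morphism\<close>

theorem theorem5p1:
  fixes sU :: "'k::field \<Rightarrow> 'u::ab_group_add \<Rightarrow> 'u"
    and sV :: "'k \<Rightarrow> 'v::ab_group_add \<Rightarrow> 'v"
    and \<rho> :: "'u list \<Rightarrow> 'u"
    and \<theta> :: "'v list \<Rightarrow> 'v"
    and \<Phi> :: "'u \<Rightarrow> 'v"
  assumes "vector_space sU"
    and "vector_space sV"
    and "lie_structure sU \<rho>"
    and "lie_structure sV \<theta>"
    and "lie_morphism sU sV \<rho> \<theta> \<Phi>"
  shows "(\<forall>p. \<forall>X\<in>cochains sU sV p.
            Delta sU sV \<rho> \<theta> \<Phi> (p + 1) (Delta sU sV \<rho> \<theta> \<Phi> p X) = 0)
       \<and> cochain_complex (cochain_scale sU sV) (cochains sU sV) (Delta sU sV \<rho> \<theta> \<Phi>)"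
proof -
  have id_U: "lie_morphism sU sU \<rho> \<rho> id" and id_V: "lie_morphism sV sV \<theta> \<theta> id"
    using assms(1,2) by (simp_all add: lie_morphism_def linear_iff_add_scale)
  interpret UV: lie_hom sU sV \<rho> \<theta> \<Phi> by (rule lie_hom.intro[OF assms])
  interpret UU: lie_hom sU sU \<rho> \<rho> id
    by (rule lie_hom.intro[OF assms(1) assms(1) assms(3) assms(3) id_U])
  interpret VV: lie_hom sV sV \<theta> \<theta> id
    by (rule lie_hom.intro[OF assms(2) assms(2) assms(4) assms(4) id_V])
  let ?d = "Delta sU sV \<rho> \<theta> \<Phi>" and ?C = "cochains sU sV" and ?s = "cochain_scale sU sV"
  have square: "?d (p + 1) (?d p X) = 0" if X: "X \<in> ?C p" for p X
  proof -
    obtain X1 X2 X3 where [simp]: "X = (X1, X2, X3)" by (cases X)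
    have mem: "X1 \<in> alt_maps sU sU (p + 1)" "X2 \<in> alt_maps sV sV (p + 1)" "X3 \<in> alt_maps sU sV p"
      using X by (auto simp: cochains_def)
    let ?\<delta> = "coboundary sV \<rho> \<theta> \<Phi>"
    \<comment> \<open>Compatibility with differences comes from additivity, applied to the
      difference plus its subtrahend.\<close>
    have diff: "?\<delta> (p + 1) ((\<Phi> \<circ> X1) - X2 \<diamondop> \<Phi>)
        = (\<Phi> \<circ> lie_coboundary sU \<rho> (p + 1) X1) - lie_coboundary sV \<theta> (p + 1) X2 \<diamondop> \<Phi>"
      using UV.coboundary_add[of "p + 1" "(\<Phi> \<circ> X1) - X2 \<diamondop> \<Phi>" "X2 \<diamondop> \<Phi>"]
      by (simp add: UV.coboundary_comp UV.coboundary_diamond algebra_simps)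
    \<comment> \<open>The two signs are those of the correction terms in degrees \<open>p\<close>
      and \<open>p + 1\<close>; they are opposite, so the two copies of the chain map difference
      cancel.\<close>
    have cancel: "fun_scale sV ((-1) ^ p) g + fun_scale sV ((-1) ^ (p + 1)) g = 0" for g :: "'u list \<Rightarrow> 'v"
      by (auto simp: fun_scale_def)
    show ?thesis
      using UU.coboundary_coboundary[OF mem(1)] VV.coboundary_coboundary[OF mem(2)]
        UV.coboundary_coboundary[OF mem(3)] diff cancel
      by (simp add: Delta_def UV.coboundary_add UV.coboundary_scale zero_prod_def)
  qed
  have scale: "vector_space ?s"
    by unfold_locales
      (auto simp: cochain_scale_def fun_scale_def algebra_simps fun_eq_iff
        UV.U.scale_right_distrib UV.V.scale_right_distrib UV.U.scale_left_distrib UV.V.scale_left_distrib)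
  have sub: "module.subspace ?s (?C p)" for p
  proof -
    interpret vector_space ?s by (rule scale)
    show ?thesis
      using assms(1,2)
      by (auto simp: subspace_def cochains_def zero_prod_def cochain_scale_def
          zero_in_alt_maps add_in_alt_maps scale_in_alt_maps)
  qed
  have closed: "?d p X \<in> ?C (p + 1)" if "X \<in> ?C p" for p X
  proof -
    obtain X1 X2 X3 where [simp]: "X = (X1, X2, X3)" by (cases X)
    have mem: "X1 \<in> alt_maps sU sU (p + 1)" "X2 \<in> alt_maps sV sV (p + 1)" "X3 \<in> alt_maps sU sV p"
      using that by (auto simp: cochains_def)
    have "\<Phi> \<circ> X1 \<in> alt_maps sU sV (p + 1)" "X2 \<diamondop> \<Phi> \<in> alt_maps sU sV (p + 1)"
      using comp_in_alt_maps[OF UV.\<Phi>.linear_axioms mem(1)] assms(1,2)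
        diamond_in_alt_maps[OF UV.\<Phi>.linear_axioms mem(2)] by blast+
    then show ?thesis
      using UU.coboundary_in_alt_maps[OF mem(1)] VV.coboundary_in_alt_maps[OF mem(2)]
        UV.coboundary_in_alt_maps[OF mem(3)] assms(1,2)
      by (simp add: Delta_def cochains_def add_in_alt_maps scale_in_alt_maps diff_in_alt_maps)
  qed
  have add: "?d p (X + Y) = ?d p X + ?d p Y" for p X Y
  proof -
    obtain X1 X2 X3 Y1 Y2 Y3 where [simp]: "X = (X1, X2, X3)" "Y = (Y1, Y2, Y3)" by (cases X, cases Y)
    have "fun_scale sV c ((\<Phi> \<circ> (X1 + Y1)) - (X2 + Y2) \<diamondop> \<Phi>)
      = fun_scale sV c ((\<Phi> \<circ> X1) - X2 \<diamondop> \<Phi>) + fun_scale sV c ((\<Phi> \<circ> Y1) - Y2 \<diamondop> \<Phi>)" for c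
      by (auto simp: fun_scale_def diamond_def UV.\<Phi>.add UV.V.scale_right_distrib
          UV.V.scale_right_diff_distrib)
    then show ?thesis
      by (simp add: Delta_def UU.coboundary_add VV.coboundary_add UV.coboundary_add algebra_simps)
  qed
  have scl: "?d p (?s c X) = ?s c (?d p X)" for p c X
  proof -
    obtain X1 X2 X3 where [simp]: "X = (X1, X2, X3)" by (cases X)
    \<comment> \<open>Here \<open>e\<close> stands for the sign \<open>(-1) ^ p\<close>, which
      commutes with the scalar \<open>c\<close>.\<close>
    have "fun_scale sV e ((\<Phi> \<circ> fun_scale sU c X1) - fun_scale sV c X2 \<diamondop> \<Phi>)
      = fun_scale sV c (fun_scale sV e ((\<Phi> \<circ> X1) - X2 \<diamondop> \<Phi>))" for e
      by (auto simp: fun_scale_def diamond_def UV.\<Phi>.scale UV.V.scale_right_diff_distrib mult.commute)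
    moreover have "fun_scale sV c (g + h) = fun_scale sV c g + fun_scale sV c h" for g h :: "'u list \<Rightarrow> 'v"
      by (auto simp: fun_scale_def UV.V.scale_right_distrib)
    ultimately show ?thesis
      by (simp add: Delta_def cochain_scale_def UU.coboundary_scale VV.coboundary_scale UV.coboundary_scale)
  qed
  show ?thesis
    unfolding cochain_complex_def using square scale sub closed add scl by blast
qed

end
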